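(* Let $n$ be a positive integer and let $A,B\in\mathcal{B}_n$. If $A\sim A^R$ and $B\sim A$, then $B\sim B^R$.
   Context: $\mathcal{B}_n$ is the set of all $n\times n$ matrices with entries in $\{0,1\}$. $A\sim B$ means that one matrix is obtained from the other by a finite (possibly empty) sequence of moves, each move taking the first row to the last place or the first column to the last place (the other rows, respectively columns, being shifted cyclically). For $A=(a_{ij})\in\mathcal{B}_n$, $A^R$ is the matrix whose $(i,j)$ entry is $a_{j,\,n-i+1}$, $1\le i,j\le n$; that is, $A^R$ is $A$ rotated by $90^\circ$ counterclockwise (the transpose of the matrix obtained from $A$ by reversing the order of its columns). *)

theory Defs
  imports "Jordan_Normal_Form.Matrix"
begin

text \<open>Matrix indices are 0-based here, so index \<open>i\<close> corresponds to the 1-based index \<open>i + 1\<close>.\<close>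

definition binary_mats :: "nat \<Rightarrow> int mat set" where
  "binary_mats n = {A \<in> carrier_mat n n. \<forall>i<n. \<forall>j<n. A $$ (i, j) \<in> {0, 1}}"

text \<open>The first row (column) goes to the last place and every other one moves back by one place.\<close>

definition shift_rows :: "'a mat \<Rightarrow> 'a mat" where
  "shift_rows A = mat (dim_row A) (dim_col A) (\<lambda>(i, j). A $$ (Suc i mod dim_row A, j))"

definition shift_cols :: "'a mat \<Rightarrow> 'a mat" where
  "shift_cols A = mat (dim_row A) (dim_col A) (\<lambda>(i, j). A $$ (i, Suc j mod dim_col A))"

inductive shift_move :: "'a mat \<Rightarrow> 'a mat \<Rightarrow> bool" where
  rows: "shift_move A (shift_rows A)"
| cols: "shift_move A (shift_cols A)"

text \<open>The disjunction renders ``one of the two matrices is obtained from the other''.\<close>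

definition shift_equiv :: "'a mat \<Rightarrow> 'a mat \<Rightarrow> bool" (infix "\<sim>\<^sub>s" 50) where
  "A \<sim>\<^sub>s B \<longleftrightarrow> shift_move\<^sup>*\<^sup>* A B \<or> shift_move\<^sup>*\<^sup>* B A"

text \<open>Rotation by 90 degrees counterclockwise. For an \<open>n \<times> n\<close> matrix the 1-based entry
  \<open>a\<close> at \<open>(j, n - i + 1)\<close> is the 0-based entry at \<open>(j, n - 1 - i)\<close>.\<close>

definition rotate_mat :: "'a mat \<Rightarrow> 'a mat" where
  "rotate_mat A = mat (dim_col A) (dim_row A) (\<lambda>(i, j). A $$ (j, dim_col A - 1 - i))"

end

theory Submission
  imports Defs
begin

text \<open>
  The relation \<open>\<sim>\<^sub>s\<close> is an equivalence, and rotation respects it; hence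
  \<open>B \<sim>\<^sub>s A \<sim>\<^sub>s A\<^sup>R \<sim>\<^sub>s B\<^sup>R\<close>.

  Reachability by moves is symmetric because the cyclic shifts have finite order: repeating a
  shift as often as the matrix has rows (columns) gives the matrix back, so the remaining
  repetitions undo a single shift (\<open>shift_move_reversible\<close>). Rotation respects reachability
  because it exchanges the two kinds of shift: a row shift of \<open>A\<close> becomes a column shift of
  the rotated matrix, and a column shift of \<open>A\<close> becomes the inverse of a row shift
  (\<open>rotate_mat_shift_move\<close>).
\<close>

lemma shift_rows_funpow:
  "(shift_rows ^^ k) A =
     mat (dim_row A) (dim_col A) (\<lambda>(i, j). A $$ ((i + k) mod dim_row A, j))"
proof (induction k)
  case 0
  show ?case by (intro eq_matI) auto
next
  case (Suc k)
  then show ?case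
    by (intro eq_matI) (auto simp: shift_rows_def mod_Suc_eq mod_add_left_eq)
qed

lemma shift_cols_funpow:
  "(shift_cols ^^ k) A =
     mat (dim_row A) (dim_col A) (\<lambda>(i, j). A $$ (i, (j + k) mod dim_col A))"
proof (induction k)
  case 0
  show ?case by (intro eq_matI) auto
next
  case (Suc k)
  then show ?case
    by (intro eq_matI) (auto simp: shift_cols_def mod_Suc_eq mod_add_left_eq)
qed

lemma shift_rows_dim_row: "(shift_rows ^^ dim_row A) A = A"
  unfolding shift_rows_funpow by (intro eq_matI) auto

lemma shift_cols_dim_col: "(shift_cols ^^ dim_col A) A = A"
  unfolding shift_cols_funpow by (intro eq_matI) auto

lemma rtranclp_funpow:
  assumes "\<And>x. r x (f x)"
  shows "r\<^sup>*\<^sup>* x ((f ^^ k) x)"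
  by (induction k) (auto intro: rtranclp.rtrancl_into_rtrancl assms)

text \<open>
  After one of the \<open>k\<close> applications, the other \<open>k - 1\<close> complete the cycle. For \<open>k = 0\<close> there is
  no cycle to complete, which is why a matrix without rows (or columns) is treated
  separately in \<open>shift_move_reversible\<close>: there a shift changes nothing.
\<close>

lemma rtranclp_back_if_funpow_fixed:
  assumes step: "\<And>x. r x (f x)" and "(f ^^ k) x = x" and "k > 0"
  shows "r\<^sup>*\<^sup>* (f x) x"
proof -
  from \<open>k > 0\<close> obtain l where "k = Suc l"
    using gr0_implies_Suc by blast
  then have "(f ^^ l) (f x) = x"
    using assms(2) by (simp add: funpow_swap1)
  then show ?thesis
    using rtranclp_funpow[of r f "f x" l] step by simp
qed

lemma shift_move_reversible:
  assumes "shift_move A B"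
  shows "shift_move\<^sup>*\<^sup>* B A"
  using assms
proof cases
  case rows
  show ?thesis
  proof (cases "dim_row A = 0")
    case True
    then have "shift_rows A = A"
      by (intro eq_matI) (auto simp: shift_rows_def)
    then show ?thesis using rows by simp
  next
    case False
    then show ?thesis
      using rtranclp_back_if_funpow_fixed[of shift_move shift_rows, OF shift_move.rows
          shift_rows_dim_row] rows by simp
  qed
next
  case cols
  show ?thesis
  proof (cases "dim_col A = 0")
    case True
    then have "shift_cols A = A"
      by (intro eq_matI) (auto simp: shift_cols_def)
    then show ?thesis using cols by simp
  next
    case False
    then show ?thesis
      using rtranclp_back_if_funpow_fixed[of shift_move shift_cols, OF shift_move.cols
          shift_cols_dim_col] cols by simp
  qed
qed

lemma shift_moves_sym:
  assumes "shift_move\<^sup>*\<^sup>* A B"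
  shows "shift_move\<^sup>*\<^sup>* B A"
  using assms
  by (induction rule: rtranclp_induct)
     (blast, meson rtranclp_trans shift_move_reversible)

lemma shift_equiv_iff_reachable: "A \<sim>\<^sub>s B \<longleftrightarrow> shift_move\<^sup>*\<^sup>* A B"
  unfolding shift_equiv_def using shift_moves_sym by blast

lemma rotate_mat_shift_rows: "rotate_mat (shift_rows A) = shift_cols (rotate_mat A)"
  by (intro eq_matI) (auto simp: rotate_mat_def shift_rows_def shift_cols_def)

text \<open>
  Rotation turns column \<open>j\<close> into row \<open>dim_col A - 1 - j\<close>. The reversed order makes a column
  shift of \<open>A\<close> a row shift in the opposite direction.
\<close>

lemma shift_rows_rotate_mat_shift_cols:
  "shift_rows (rotate_mat (shift_cols A)) = rotate_mat A"
proof (intro eq_matI)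
  fix i j
  assume "i < dim_row (rotate_mat A)" "j < dim_col (rotate_mat A)"
  then have ij: "i < dim_col A" "j < dim_row A"
    by (simp_all add: rotate_mat_def)
  let ?n = "dim_col A"
  have "Suc (?n - 1 - Suc i mod ?n) mod ?n = ?n - 1 - i"
  proof (cases "Suc i = ?n")
    case True
    then show ?thesis by auto
  next
    case False
    then have "Suc i < ?n" using ij by simp
    then show ?thesis by (simp add: Suc_diff_Suc)
  qed
  then show "shift_rows (rotate_mat (shift_cols A)) $$ (i, j) = rotate_mat A $$ (i, j)"
    using ij by (simp add: rotate_mat_def shift_rows_def shift_cols_def)
qed (simp_all add: rotate_mat_def shift_rows_def shift_cols_def)

lemma rotate_mat_shift_move:
  assumes "shift_move A B"
  shows "shift_move\<^sup>*\<^sup>* (rotate_mat A) (rotate_mat B)"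
  using assms
proof cases
  case rows
  then show ?thesis
    using shift_move.cols[of "rotate_mat A"] by (simp add: rotate_mat_shift_rows)
next
  case cols
  then show ?thesis
    using shift_move.rows[of "rotate_mat B"]
    by (intro shift_move_reversible) (simp add: shift_rows_rotate_mat_shift_cols)
qed

lemma rotate_mat_shift_moves:
  assumes "shift_move\<^sup>*\<^sup>* A B"
  shows "shift_move\<^sup>*\<^sup>* (rotate_mat A) (rotate_mat B)"
  using assms
  by (induction rule: rtranclp_induct)
     (blast, meson rtranclp_trans rotate_mat_shift_move)

theorem theorem2:
  fixes n :: nat and A B :: "int mat"
  assumes "n > 0"
    and "A \<in> binary_mats n" and "B \<in> binary_mats n"
    and "A \<sim>\<^sub>s rotate_mat A"
    and "B \<sim>\<^sub>s A"
  shows "B \<sim>\<^sub>s rotate_mat B"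
proof -
  have BA: "shift_move\<^sup>*\<^sup>* B A" and AR: "shift_move\<^sup>*\<^sup>* A (rotate_mat A)"
    using assms by (simp_all add: shift_equiv_iff_reachable)
  have "shift_move\<^sup>*\<^sup>* (rotate_mat A) (rotate_mat B)"
    by (rule rotate_mat_shift_moves[OF shift_moves_sym[OF BA]])
  then show ?thesis
    unfolding shift_equiv_iff_reachable using BA AR by (meson rtranclp_trans)
qed

end
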